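(* Assume Dickson's Conjecture. The anchors can be chosen so as to make the galaxy $\mathbf{G}(\omega)$ contain (1) no prime numbers, or (2) infinitely many prime numbers. Precisely: for each of the two properties (1) $\mathbf{G}(\omega)$ contains no prime numbers, (2) $\mathbf{G}(\omega)$ contains infinitely many prime numbers, there is an admissible choice of anchors $s(p,n) \in \mathbb{Z}$ ($p$ prime, $n \ge 0$) such that for every $s \in \mathbb{Z}$ one has $n_p(s) = 0$ for all sufficiently large primes $p$, and such that, with $a_s = \prod_p p^{n_p(s)}$, for every proper elementary extension $({}^*\mathbb{Z}, <, +, \times, 0, 1)$ of $(\mathbb{Z}, <, +, \times, 0, 1)$ there exists $\omega \in {}^*\mathbb{Z} \setminus \mathbb{Z}$ for which every $s \in \mathbb{Z}$ satisfies $\omega - s = a_s \cdot \pi_s$ with $\pi_s \in {}^*\mathbb{Z}$ an unlimited prime number, and for which $\mathbf{G}(\omega)$ has the property in question.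
   Context: Dickson's Conjecture is the following statement: Let $\ell \ge 1$ and $f_i(x) = c_i + b_i x$ with $c_i, b_i$ integers, $b_i \ge 1$ ($i = 1, \ldots, \ell$). If there is no integer $n > 1$ that divides $\prod_{i=1}^{\ell} f_i(k)$ for every integer $k$, then there exist infinitely many natural numbers $m$ such that all the numbers $f_1(m), \ldots, f_\ell(m)$ are prime. A choice of anchors is an assignment of an integer $s(p,n)$ to each prime $p$ and each integer $n \ge 0$. Given a choice of anchors, for $s \in \mathbb{Z}$ and $p$ prime, $n_p(s)$ is the highest exponent $n \ge 0$ for which $s \equiv s(p,n) \bmod p^n$; the choice of anchors is admissible if $n_p(s)$ exists (i.e. a highest such exponent exists) for all primes $p$ and all $s \in \mathbb{Z}$. An element of ${}^*\mathbb{Z}$ is limited if its absolute value is bounded by an element of $\mathbb{Z}$ (equivalently, it belongs to $\mathbb{Z}$), and unlimited otherwise. The galaxy of $\omega$ is $\mathbf{G}(\omega) = \{\omega - s \mid s \in {}^*\mathbb{Z} \text{ limited}\}$. A prime number in ${}^*\mathbb{Z}$ is an element satisfying in ${}^*\mathbb{Z}$ the first-order definition of a (positive) prime number. *)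

theory Defs
  imports "HOL-Number_Theory.Cong"
begin

definition Dickson_Conjecture :: bool where
  "Dickson_Conjecture \<longleftrightarrow>
    (\<forall>(l::nat) (b :: nat \<Rightarrow> int) (c :: nat \<Rightarrow> int).
      l \<ge> 1 \<longrightarrow> (\<forall>i\<in>{1..l}. b i \<ge> 1) \<longrightarrow>
      \<not> (\<exists>n::int. n > 1 \<and> (\<forall>k::int. n dvd (\<Prod>i=1..l. c i + b i * k))) \<longrightarrow>
      infinite {m::nat. \<forall>i\<in>{1..l}. prime (c i + b i * int m)})"


section \<open>Anchors\<close>

text \<open>
  An assignment of anchors is given by \<open>s p n\<close>; only its values at primes \<open>p\<close> are ever used.
\<close>

type_synonym anchors = "nat \<Rightarrow> nat \<Rightarrow> int"

definition admissible :: "anchors \<Rightarrow> bool" where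
  "admissible s \<longleftrightarrow>
    (\<forall>p k. prime p \<longrightarrow>
      (\<exists>n. [k = s p n] (mod int p ^ n) \<and> (\<forall>m. [k = s p m] (mod int p ^ m) \<longrightarrow> m \<le> n)))"

definition anchor_exp :: "anchors \<Rightarrow> nat \<Rightarrow> int \<Rightarrow> nat" where
  "anchor_exp s p k = (GREATEST n. [k = s p n] (mod int p ^ n))"

definition exponents_eventually_zero :: "anchors \<Rightarrow> bool" where
  "exponents_eventually_zero s \<longleftrightarrow>
    (\<forall>k. \<exists>N. \<forall>p>N. prime p \<longrightarrow> anchor_exp s p k = 0)"

text \<open>
  The infinite product over all primes, written as the product of its factors different from 1.
  There are finitely many of these whenever \<open>exponents_eventually_zero\<close> holds.
\<close>

definition anchor_prod :: "anchors \<Rightarrow> int \<Rightarrow> int" where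
  "anchor_prod s k = (\<Prod>p | prime p \<and> anchor_exp s p k \<noteq> 0. int p ^ anchor_exp s p k)"


section \<open>First-order logic of \<open>(<, +, \<times>, 0, 1)\<close>\<close>

datatype tm = Var nat | Zero | One | Add tm tm | Mul tm tm

datatype fm = Less tm tm | Equal tm tm | Neg fm | Conj fm fm | Exists nat fm

abbreviation Imp :: "fm \<Rightarrow> fm \<Rightarrow> fm" where
  "Imp \<phi> \<psi> \<equiv> Neg (Conj \<phi> (Neg \<psi>))"

abbreviation Disj :: "fm \<Rightarrow> fm \<Rightarrow> fm" where
  "Disj \<phi> \<psi> \<equiv> Neg (Conj (Neg \<phi>) (Neg \<psi>))"

abbreviation Forall :: "nat \<Rightarrow> fm \<Rightarrow> fm" where
  "Forall x \<phi> \<equiv> Neg (Exists x (Neg \<phi>))"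

record 'a struct =
  univ :: "'a set"
  lt :: "'a \<Rightarrow> 'a \<Rightarrow> bool"
  add :: "'a \<Rightarrow> 'a \<Rightarrow> 'a"
  mul :: "'a \<Rightarrow> 'a \<Rightarrow> 'a"
  zero :: 'a
  one :: 'a

definition is_struct :: "'a struct \<Rightarrow> bool" where
  "is_struct M \<longleftrightarrow> zero M \<in> univ M \<and> one M \<in> univ M \<and>
    (\<forall>x\<in>univ M. \<forall>y\<in>univ M. add M x y \<in> univ M \<and> mul M x y \<in> univ M)"

definition int_struct :: "int struct" where
  "int_struct = \<lparr>univ = UNIV, lt = (<), add = (+), mul = (*), zero = 0, one = 1\<rparr>"

primrec tm_val :: "'a struct \<Rightarrow> (nat \<Rightarrow> 'a) \<Rightarrow> tm \<Rightarrow> 'a" where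
  "tm_val M e (Var x) = e x"
| "tm_val M e Zero = zero M"
| "tm_val M e One = one M"
| "tm_val M e (Add t u) = add M (tm_val M e t) (tm_val M e u)"
| "tm_val M e (Mul t u) = mul M (tm_val M e t) (tm_val M e u)"

primrec sat :: "'a struct \<Rightarrow> (nat \<Rightarrow> 'a) \<Rightarrow> fm \<Rightarrow> bool" where
  "sat M e (Less t u) \<longleftrightarrow> lt M (tm_val M e t) (tm_val M e u)"
| "sat M e (Equal t u) \<longleftrightarrow> tm_val M e t = tm_val M e u"
| "sat M e (Neg \<phi>) \<longleftrightarrow> \<not> sat M e \<phi>"
| "sat M e (Conj \<phi> \<psi>) \<longleftrightarrow> sat M e \<phi> \<and> sat M e \<psi>"
| "sat M e (Exists x \<phi>) \<longleftrightarrow> (\<exists>a\<in>univ M. sat M (e(x := a)) \<phi>)"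

text \<open>
  An elementary extension of the integers is a structure \<open>M\<close> together with an elementary
  embedding \<open>\<iota>\<close> of the integers into \<open>M\<close>; \<open>range \<iota>\<close> is the copy of the integers inside \<open>M\<close>.
\<close>

definition proper_elementary_extension :: "'a struct \<Rightarrow> (int \<Rightarrow> 'a) \<Rightarrow> bool" where
  "proper_elementary_extension M \<iota> \<longleftrightarrow>
    is_struct M \<and> range \<iota> \<subset> univ M \<and>
    (\<forall>\<phi> e. sat M (\<iota> \<circ> e) \<phi> \<longleftrightarrow> sat int_struct e \<phi>)"

text \<open>\<open>x\<close> (variable 0) exceeds 1, and its only positive divisors are 1 and \<open>x\<close>.\<close>

definition prime_fm :: fm where
  "prime_fm =
    Conj (Less One (Var 0))
      (Forall 1 (Imp (Conj (Less Zero (Var 1)) (Exists 2 (Equal (Mul (Var 1) (Var 2)) (Var 0))))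
        (Disj (Equal (Var 1) One) (Equal (Var 1) (Var 0)))))"

definition prime_in :: "'a struct \<Rightarrow> 'a \<Rightarrow> bool" where
  "prime_in M x \<longleftrightarrow> x \<in> univ M \<and> sat M (\<lambda>_. x) prime_fm"

lemma prime_in_int_struct: "prime_in int_struct x \<longleftrightarrow> prime x"
proof -
  have "prime_in int_struct x \<longleftrightarrow> x > 1 \<and> (\<forall>y. y > 0 \<longrightarrow> y dvd x \<longrightarrow> y = 1 \<or> y = x)"
    by (auto simp: prime_in_def prime_fm_def int_struct_def dvd_def)
  also have "\<dots> \<longleftrightarrow> prime x"
    unfolding prime_int_iff by (auto simp: order_le_less dest: zdvd_imp_le)
  finally show ?thesis .
qed


section \<open>Galaxies\<close>

definition diff :: "'a struct \<Rightarrow> 'a \<Rightarrow> 'a \<Rightarrow> 'a" where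
  "diff M x y = (THE d. d \<in> univ M \<and> add M d y = x)"

definition abs_in :: "'a struct \<Rightarrow> 'a \<Rightarrow> 'a" where
  "abs_in M x = (if lt M x (zero M) then diff M (zero M) x else x)"

definition limited :: "'a struct \<Rightarrow> (int \<Rightarrow> 'a) \<Rightarrow> 'a \<Rightarrow> bool" where
  "limited M \<iota> x \<longleftrightarrow> (\<exists>n. lt M (abs_in M x) (\<iota> n) \<or> abs_in M x = \<iota> n)"

definition galaxy :: "'a struct \<Rightarrow> (int \<Rightarrow> 'a) \<Rightarrow> 'a \<Rightarrow> 'a set" where
  "galaxy M \<iota> \<omega> = {diff M \<omega> x | x. x \<in> univ M \<and> limited M \<iota> x}"

definition galaxy_no_primes :: "'a struct \<Rightarrow> (int \<Rightarrow> 'a) \<Rightarrow> 'a \<Rightarrow> bool" where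
  "galaxy_no_primes M \<iota> \<omega> \<longleftrightarrow> \<not> (\<exists>x\<in>galaxy M \<iota> \<omega>. prime_in M x)"

definition galaxy_inf_primes :: "'a struct \<Rightarrow> (int \<Rightarrow> 'a) \<Rightarrow> 'a \<Rightarrow> bool" where
  "galaxy_inf_primes M \<iota> \<omega> \<longleftrightarrow> infinite {x \<in> galaxy M \<iota> \<omega>. prime_in M x}"

definition follows_anchors :: "anchors \<Rightarrow> 'a struct \<Rightarrow> (int \<Rightarrow> 'a) \<Rightarrow> 'a \<Rightarrow> bool" where
  "follows_anchors s M \<iota> \<omega> \<longleftrightarrow>
    (\<forall>k::int. \<exists>\<pi>\<in>univ M. prime_in M \<pi> \<and> \<not> limited M \<iota> \<pi> \<and>
      diff M \<omega> (\<iota> k) = mul M (\<iota> (anchor_prod s k)) \<pi>)"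

text \<open>
  \<open>good_anchors TYPE('a) P s\<close> says that \<open>s\<close> is as required and that every proper elementary
  extension whose universe is a set of elements of type \<open>'a\<close> contains an \<open>\<omega>\<close> as required with
  property \<open>P\<close>.

  HOL cannot quantify over types inside a formula, so ``there is \<open>s\<close> such that for all proper
  elementary extensions'' is not captured by \<open>\<exists>s. good_anchors TYPE('a) P s\<close> alone: with a free
  type variable \<open>'a\<close>, the anchors would be allowed to depend on \<open>'a\<close>. To keep the quantifiers in
  the right order one states \<open>\<exists>s. good_anchors TYPE(nat) P s\<close>, in which no type variable occurs,
  together with \<open>\<forall>s. good_anchors TYPE(nat) P s \<longrightarrow> good_anchors TYPE('a) P s\<close> for arbitrary \<open>'a\<close>.
  One and the same \<open>s\<close>, obtained from the first part, then serves all extensions over all types.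
\<close>

definition good_anchors ::
    "'a itself \<Rightarrow> ('a struct \<Rightarrow> (int \<Rightarrow> 'a) \<Rightarrow> 'a \<Rightarrow> bool) \<Rightarrow> anchors \<Rightarrow> bool" where
  "good_anchors U P s \<longleftrightarrow>
    admissible s \<and> exponents_eventually_zero s \<and>
    (\<forall>(M :: 'a struct) \<iota>. proper_elementary_extension M \<iota> \<longrightarrow>
      (\<exists>\<omega> \<in> univ M - range \<iota>. follows_anchors s M \<iota> \<omega> \<and> P M \<iota> \<omega>))"

end

(* Let the anchors approximate p-adic integers alpha_p outside Z, so that n_p(k) is the p-adic
   valuation of alpha_p - k. By the Chinese remainder theorem and Dickson's conjecture, for every N
   there is an integer x > N such that (x - k) / a_k is a prime > N for all |k| < N. If k |-> a_k is
   arithmetically definable, this is a first-order sentence, so it holds in every elementary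
   extension, and an unlimited N yields the required omega, whatever the saturation of the extension.

   Taking for alpha_p the rationals 2/3 (p = 2), 1/c (p = 3) and 1/4 (p > 3) makes a_k definable:
   it is built from the 2-part of 3k - 2, the 3-part of ck - 1 and the part of 4k - 1 prime to 3.
   For c = 4 no a_k is 1, so no omega - k is prime. For c = 2 one has a_k = 1 whenever k is odd and
   4k - 1 is a power of 3, so infinitely many omega - k are prime.

   That anchors which serve the extensions on the natural numbers serve all extensions is the
   downward Loewenheim-Skolem theorem. *)
theory Submission
  imports Defs "HOL-Library.Countable_Set"
begin

section \<open>Elementary extensions of the integers\<close>

lemma int_struct_simps [simp]:
  "univ int_struct = UNIV" "lt int_struct = (<)" "add int_struct = (+)" "mul int_struct = (*)"
  "zero int_struct = 0" "one int_struct = 1"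
  by (simp_all add: int_struct_def)

section \<open>Free variables and the coincidence lemma\<close>

primrec fv_tm :: "tm \<Rightarrow> nat set" where
  "fv_tm (Var x) = {x}"
| "fv_tm Zero = {}"
| "fv_tm One = {}"
| "fv_tm (Add t u) = fv_tm t \<union> fv_tm u"
| "fv_tm (Mul t u) = fv_tm t \<union> fv_tm u"

primrec fv :: "fm \<Rightarrow> nat set" where
  "fv (Less t u) = fv_tm t \<union> fv_tm u"
| "fv (Equal t u) = fv_tm t \<union> fv_tm u"
| "fv (Neg \<phi>) = fv \<phi>"
| "fv (Conj \<phi> \<psi>) = fv \<phi> \<union> fv \<psi>"
| "fv (Exists x \<phi>) = fv \<phi> - {x}"

lemma finite_fv_tm: "finite (fv_tm t)"
  by (induction t) simp_all

lemma finite_fv: "finite (fv \<phi>)"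
  by (induction \<phi>) (simp_all add: finite_fv_tm)

lemma tm_val_cong: "\<forall>i\<in>fv_tm t. e i = e' i \<Longrightarrow> tm_val M e t = tm_val M e' t"
proof (induction t)
  case (Add t u)
  then have "tm_val M e t = tm_val M e' t" "tm_val M e u = tm_val M e' u"
    by auto
  then show ?case
    by simp
next
  case (Mul t u)
  then have "tm_val M e t = tm_val M e' t" "tm_val M e u = tm_val M e' u"
    by auto
  then show ?case
    by simp
qed simp_all

text \<open>Serves to cut an environment down to finitely many values in the Skolem hull, and to
  compare formulas evaluated in environments that differ at other variables.\<close>

lemma sat_cong: "\<forall>i\<in>fv \<phi>. e i = e' i \<Longrightarrow> sat M e \<phi> = sat M e' \<phi>"
proof (induction \<phi> arbitrary: e e')
  case (Less t u)
  then have "tm_val M e t = tm_val M e' t" "tm_val M e u = tm_val M e' u"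
    by (intro tm_val_cong; simp)+
  then show ?case
    by simp
next
  case (Equal t u)
  then have "tm_val M e t = tm_val M e' t" "tm_val M e u = tm_val M e' u"
    by (intro tm_val_cong; simp)+
  then show ?case
    by simp
next
  case (Neg \<phi>)
  then have "sat M e \<phi> = sat M e' \<phi>"
    by (intro Neg.IH) simp
  then show ?case
    by simp
next
  case (Conj \<phi> \<psi>)
  then have "sat M e \<phi> = sat M e' \<phi>" "sat M e \<psi> = sat M e' \<psi>"
    by (intro Conj.IH; simp)+
  then show ?case
    by simp
next
  case (Exists x \<phi>)
  then have "sat M (e(x := a)) \<phi> = sat M (e'(x := a)) \<phi>" for a
    by (intro Exists.IH) simp
  then show ?case
    by simp
qed

lemma sat_prime_fm_iff_prime_in:
  "e 0 \<in> univ M \<Longrightarrow> sat M e prime_fm \<longleftrightarrow> prime_in M (e 0)"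
  by (simp add: prime_in_def prime_fm_def)

lemma sat_int_prime_fm [simp]: "sat int_struct e prime_fm \<longleftrightarrow> prime (e 0)"
  using sat_prime_fm_iff_prime_in[of e int_struct] by (simp add: prime_in_int_struct)

section \<open>Transfer of addition and order from the integers\<close>

locale elementary_extension =
  fixes M :: "'a struct" and \<iota> :: "int \<Rightarrow> 'a"
  assumes extension: "proper_elementary_extension M \<iota>"
begin

lemma elementary: "sat M (\<iota> \<circ> e) \<phi> \<longleftrightarrow> sat int_struct e \<phi>"
  using extension by (simp add: proper_elementary_extension_def)

text \<open>Meant for sentences: their truth does not depend on the environment, and the constant 0
  is one of the form that \<open>elementary\<close> accepts.\<close>

lemma transfer_true: "(\<And>e. sat int_struct e \<phi>) \<Longrightarrow> sat M (\<iota> \<circ> (\<lambda>_. 0)) \<phi>"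
  by (simp add: elementary)

lemma closed [simp]:
  "zero M \<in> univ M" "one M \<in> univ M"
  "x \<in> univ M \<Longrightarrow> y \<in> univ M \<Longrightarrow> add M x y \<in> univ M"
  "x \<in> univ M \<Longrightarrow> y \<in> univ M \<Longrightarrow> mul M x y \<in> univ M"
  "\<iota> k \<in> univ M"
  using extension unfolding proper_elementary_extension_def is_struct_def by blast+

lemma emb_zero: "\<iota> 0 = zero M"
  using elementary[of "\<lambda>_. 0" "Equal (Var 0) Zero"] by simp

lemma emb_one: "\<iota> 1 = one M"
  using elementary[of "\<lambda>_. 1" "Equal (Var 0) One"] by simp

lemma emb_lt [simp]: "lt M (\<iota> a) (\<iota> b) \<longleftrightarrow> a < b"
  using elementary[of "(\<lambda>_. b)(0 := a)" "Less (Var 0) (Var 1)"] by simp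

lemma emb_eq [simp]: "\<iota> a = \<iota> b \<longleftrightarrow> a = b"
  using elementary[of "(\<lambda>_. b)(0 := a)" "Equal (Var 0) (Var 1)"] by simp

lemma emb_add: "add M (\<iota> a) (\<iota> b) = \<iota> (a + b)"
  using elementary[of "(\<lambda>_. b)(0 := a, 2 := a + b)" "Equal (Add (Var 0) (Var 1)) (Var 2)"] by simp

lemma add_cancel:
  assumes "x \<in> univ M" "y \<in> univ M" "z \<in> univ M" "add M x z = add M y z"
  shows "x = y"
  using transfer_true[of "Forall 0 (Forall 1 (Forall 2
    (Imp (Equal (Add (Var 0) (Var 2)) (Add (Var 1) (Var 2))) (Equal (Var 0) (Var 1)))))"] assms
  by auto

lemma add_cancel_left:
  assumes "x \<in> univ M" "y \<in> univ M" "z \<in> univ M" "add M z x = add M z y"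
  shows "x = y"
  using transfer_true[of "Forall 0 (Forall 1 (Forall 2
    (Imp (Equal (Add (Var 2) (Var 0)) (Add (Var 2) (Var 1))) (Equal (Var 0) (Var 1)))))"] assms
  by auto

lemma subtract_exists:
  assumes "x \<in> univ M" "y \<in> univ M"
  shows "\<exists>d\<in>univ M. add M d y = x"
proof -
  have "\<exists>d. d + b = a" for a b :: int
    by (rule exI[of _ "a - b"]) simp
  then show ?thesis
    using transfer_true[of "Forall 0 (Forall 1 (Exists 2 (Equal (Add (Var 2) (Var 1)) (Var 0))))"]
      assms by simp
qed

lemma diff_eq_iff:
  assumes "x \<in> univ M" "y \<in> univ M" "d \<in> univ M"
  shows "diff M x y = d \<longleftrightarrow> add M d y = x"
proof -
  obtain d' where d': "d' \<in> univ M" "add M d' y = x"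
    using subtract_exists[OF assms(1,2)] by blast
  then have "diff M x y = d'"
    unfolding diff_def using assms by (intro the_equality) (blast intro: add_cancel)+
  then show ?thesis
    using d' assms add_cancel[of d d' y] by auto
qed

lemma diff_in [simp]: "x \<in> univ M \<Longrightarrow> y \<in> univ M \<Longrightarrow> diff M x y \<in> univ M"
  using subtract_exists[of x y] diff_eq_iff[of x y] by metis

lemma add_diff: "x \<in> univ M \<Longrightarrow> y \<in> univ M \<Longrightarrow> add M (diff M x y) y = x"
  using diff_eq_iff[of x y "diff M x y"] by simp

section \<open>Limited elements and galaxies\<close>

lemma abs_in_in [simp]: "x \<in> univ M \<Longrightarrow> abs_in M x \<in> univ M"
  by (simp add: abs_in_def)

text \<open>By transfer no element lies strictly between m and m + 1, so induction on a natural
  upper bound exhausts the nonnegative elements below it.\<close>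

lemma not_less_zero_less_emb_imp_range:
  assumes "x \<in> univ M" "\<not> lt M x (zero M)" "lt M x (\<iota> n)"
  shows "x \<in> range \<iota>"
proof -
  have "x \<in> range \<iota>" if "lt M x (\<iota> (int m))" for m
    using that
  proof (induction m)
    case 0
    then show ?case using assms by (simp add: emb_zero)
  next
    case (Suc m)
    then have "lt M x (add M (\<iota> (int m)) (one M))"
      by (simp add: emb_one[symmetric] emb_add add.commute)
    moreover have "sat M (\<iota> \<circ> (\<lambda>_. int m)) (Forall 0 (Imp (Less (Var 0) (Add (Var 1) One))
        (Disj (Less (Var 0) (Var 1)) (Equal (Var 0) (Var 1)))))"
      unfolding elementary by auto
    ultimately show ?case
      using Suc.IH assms(1) by auto
  qed
  \<comment> \<open>The induction needs a natural bound; \<open>n\<close> is at most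
    \<open>nat n\<close>, also when \<open>n\<close> is negative.\<close>
  moreover have "sat M (\<iota> \<circ> (\<lambda>_. int (nat n))(0 := n))
      (Forall 2 (Imp (Less (Var 2) (Var 0)) (Less (Var 2) (Var 1))))"
    unfolding elementary by auto
  then have "lt M x (\<iota> (int (nat n)))"
    using assms by (simp del: int_nat_eq)
  ultimately show ?thesis
    by blast
qed

lemma abs_in_not_less_zero:
  assumes "x \<in> univ M"
  shows "\<not> lt M (abs_in M x) (zero M)"
proof -
  have "sat M (\<iota> \<circ> (\<lambda>_. 0)) (Forall 0 (Forall 1 (Imp (Conj (Less (Var 0) Zero)
      (Equal (Add (Var 1) (Var 0)) Zero)) (Neg (Less (Var 1) Zero)))))"
    by (rule transfer_true) auto
  then have "\<forall>x\<in>univ M. lt M x (zero M) \<longrightarrow>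
      (\<forall>d\<in>univ M. add M d x = zero M \<longrightarrow> \<not> lt M d (zero M))"
    by simp
  then have "\<not> lt M d (zero M)" if "lt M x (zero M)" "d \<in> univ M" "add M d x = zero M" for d
    using assms that by blast
  then show ?thesis
    using assms diff_eq_iff[of "zero M" x "diff M (zero M) x"] by (auto simp: abs_in_def)
qed

lemma abs_in_emb: "abs_in M (\<iota> k) = \<iota> \<bar>k\<bar>"
  using diff_eq_iff[of "zero M" "\<iota> k" "\<iota> (- k)"]
  by (auto simp: abs_in_def emb_zero[symmetric] emb_add)

lemma abs_in_range_iff:
  assumes "x \<in> univ M"
  shows "abs_in M x \<in> range \<iota> \<longleftrightarrow> x \<in> range \<iota>"
proof
  assume "abs_in M x \<in> range \<iota>"
  then obtain n where n: "abs_in M x = \<iota> n" by auto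
  show "x \<in> range \<iota>"
  proof (cases "lt M x (zero M)")
    case True
    then have "add M (\<iota> n) x = \<iota> 0"
      using n assms diff_eq_iff[of "zero M" x "\<iota> n"] by (simp add: abs_in_def emb_zero)
    also have "\<dots> = add M (\<iota> n) (\<iota> (- n))"
      by (simp add: emb_add)
    finally have "x = \<iota> (- n)"
      by (rule add_cancel_left[OF assms closed(5) closed(5)])
    then show ?thesis by simp
  qed (use n in \<open>simp add: abs_in_def\<close>)
qed (auto simp: abs_in_emb)

text \<open>An absolute value is nonnegative, so an integer bound forces it, and with it
  \<open>x\<close>, into the copy of the integers.\<close>

lemma limited_iff_range:
  assumes "x \<in> univ M"
  shows "limited M \<iota> x \<longleftrightarrow> x \<in> range \<iota>"
proof -
  have "limited M \<iota> x \<longleftrightarrow> abs_in M x \<in> range \<iota>"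
    unfolding limited_def
    using not_less_zero_less_emb_imp_range[OF abs_in_in abs_in_not_less_zero] assms by blast
  then show ?thesis
    using abs_in_range_iff assms by simp
qed

text \<open>Replaces the definite description \<open>diff\<close> by an equation of the language, to
  which transfer applies.\<close>

lemma follows_anchors_iff:
  assumes "\<omega> \<in> univ M"
  shows "follows_anchors s M \<iota> \<omega> \<longleftrightarrow> (\<forall>k. \<exists>\<pi>\<in>univ M - range \<iota>.
    prime_in M \<pi> \<and> add M (mul M (\<iota> (anchor_prod s k)) \<pi>) (\<iota> k) = \<omega>)"
  unfolding follows_anchors_def using assms by (auto simp: limited_iff_range diff_eq_iff)

lemma galaxy_eq:
  assumes "\<omega> \<in> univ M"
  shows "galaxy M \<iota> \<omega> = {d \<in> univ M. \<exists>k. add M d (\<iota> k) = \<omega>}"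
proof -
  have "galaxy M \<iota> \<omega> = (\<lambda>k. diff M \<omega> (\<iota> k)) ` UNIV"
    unfolding galaxy_def using limited_iff_range by auto
  also have "\<dots> = {d \<in> univ M. \<exists>k. diff M \<omega> (\<iota> k) = d}"
    using assms by auto
  finally show ?thesis
    using assms by (simp add: diff_eq_iff cong: conj_cong)
qed

text \<open>Since the order is linear, the absolute value of any element outside the copy of the
  integers exceeds every integer.\<close>

lemma unlimited_exists:
  obtains c where "c \<in> univ M" "\<And>n. lt M (\<iota> n) c"
proof -
  obtain c where c: "c \<in> univ M" "c \<notin> range \<iota>"
    using extension by (auto simp: proper_elementary_extension_def)
  have "sat M (\<iota> \<circ> (\<lambda>_. 0)) (Forall 0 (Forall 1 (Disj (Less (Var 0) (Var 1))
      (Disj (Equal (Var 0) (Var 1)) (Less (Var 1) (Var 0))))))"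
    by (rule transfer_true) auto
  then have trichotomy: "\<forall>x\<in>univ M. \<forall>y\<in>univ M. lt M x y \<or> x = y \<or> lt M y x"
    by simp
  have "lt M (\<iota> n) (abs_in M c)" for n
    using limited_iff_range[OF c(1)] c trichotomy abs_in_in[OF c(1)] closed(5)[of n]
    unfolding limited_def by metis
  then show ?thesis
    using that[of "abs_in M c"] c by simp
qed

section \<open>Primes in the galaxy\<close>

lemma mul_emb_one: "x \<in> univ M \<Longrightarrow> mul M (\<iota> 1) x = x"
  using transfer_true[of "Forall 0 (Equal (Mul One (Var 0)) (Var 0))"] by (simp add: emb_one)

text \<open>A product of two factors greater than 1 is composite in the integers. In the transferred
  sentence variable 4 is \<open>a\<close> and variable 3 is \<open>x\<close>; the product is called
  variable 0 because \<open>prime_fm\<close> speaks of that variable.\<close>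

lemma not_prime_in_mul:
  assumes "a > 1" "x \<in> univ M" "prime_in M x"
  shows "\<not> prime_in M (mul M (\<iota> a) x)"
proof -
  have "sat M (\<iota> \<circ> (\<lambda>_. a)) (Forall 3 (Imp (Less One (Var 3))
      (Forall 0 (Imp (Equal (Var 0) (Mul (Var 4) (Var 3))) (Neg prime_fm)))))"
    unfolding elementary using assms(1) by (auto dest!: prime_imp_prime_elem prime_elem_multD)
  moreover have "lt M (one M) x"
    using assms by (simp add: prime_in_def prime_fm_def)
  ultimately show ?thesis
    using assms(2) by (simp add: sat_prime_fm_iff_prime_in)
qed

text \<open>Every element of the galaxy is some \<omega> - k, a prime multiplied by a_k > 1.\<close>

lemma galaxy_no_primesI:
  assumes "\<omega> \<in> univ M" "follows_anchors s M \<iota> \<omega>" "\<And>k. anchor_prod s k > 1"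
  shows "galaxy_no_primes M \<iota> \<omega>"
  unfolding galaxy_no_primes_def
proof (clarify)
  fix x assume "x \<in> galaxy M \<iota> \<omega>" and prime: "prime_in M x"
  then obtain k where x: "x \<in> univ M" "add M x (\<iota> k) = \<omega>"
    using assms(1) by (auto simp: galaxy_eq)
  obtain \<pi> where \<pi>: "\<pi> \<in> univ M" "prime_in M \<pi>" "add M (mul M (\<iota> (anchor_prod s k)) \<pi>) (\<iota> k) = \<omega>"
    using assms(2) unfolding follows_anchors_iff[OF assms(1)] by blast
  then have "x = mul M (\<iota> (anchor_prod s k)) \<pi>"
    using x by - (rule add_cancel[where z = "\<iota> k"], simp_all)
  then show False
    using prime not_prime_in_mul[OF assms(3) \<pi>(1,2)] by simp
qed

text \<open>Where a_k = 1 the element \<omega> - k is itself the prime \<pi>, and different k give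
  different elements.\<close>

lemma galaxy_inf_primesI:
  assumes \<omega>: "\<omega> \<in> univ M" and follows: "follows_anchors s M \<iota> \<omega>"
    and inf: "infinite {k. anchor_prod s k = 1}"
  shows "galaxy_inf_primes M \<iota> \<omega>"
proof -
  let ?K = "{k. anchor_prod s k = 1}"
  have "inj (\<lambda>k. diff M \<omega> (\<iota> k))"
  proof (rule injI)
    fix j k assume eq: "diff M \<omega> (\<iota> j) = diff M \<omega> (\<iota> k)"
    have "add M (diff M \<omega> (\<iota> k)) (\<iota> j) = add M (diff M \<omega> (\<iota> k)) (\<iota> k)"
      using add_diff[OF \<omega> closed(5)[of j]] add_diff[OF \<omega> closed(5)[of k]] eq by simp
    then have "\<iota> j = \<iota> k"
      by (rule add_cancel_left[OF closed(5) closed(5) diff_in[OF \<omega> closed(5)]])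
    then show "j = k"
      by simp
  qed
  then have "inj_on (\<lambda>k. diff M \<omega> (\<iota> k)) ?K"
    by (rule inj_on_subset) simp
  then have "infinite ((\<lambda>k. diff M \<omega> (\<iota> k)) ` ?K)"
    using inf finite_imageD by blast
  moreover have "diff M \<omega> (\<iota> k) \<in> {x \<in> galaxy M \<iota> \<omega>. prime_in M x}" if k: "k \<in> ?K" for k
  proof -
    obtain \<pi> where \<pi>: "\<pi> \<in> univ M" "prime_in M \<pi>"
        "add M (mul M (\<iota> (anchor_prod s k)) \<pi>) (\<iota> k) = \<omega>"
      using follows unfolding follows_anchors_iff[OF \<omega>] by blast
    then have add: "add M \<pi> (\<iota> k) = \<omega>"
      using k by (simp add: mul_emb_one)
    then have "\<pi> \<in> galaxy M \<iota> \<omega>"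
      using \<pi> \<omega> by (auto simp: galaxy_eq)
    moreover have "diff M \<omega> (\<iota> k) = \<pi>"
      using add diff_eq_iff[OF \<omega> closed(5) \<pi>(1)] by simp
    ultimately show ?thesis
      using \<pi>(2) by simp
  qed
  ultimately show ?thesis
    unfolding galaxy_inf_primes_def by (meson finite_subset image_subsetI)
qed

end

section \<open>Reduction to countable extensions\<close>

instance tm :: countable by countable_datatype
instance fm :: countable by countable_datatype

text \<open>The Skolem hull is the range of a function on this type, hence countable.\<close>

datatype hull_term = Base "int option" | Witness nat fm "hull_term list"

instance hull_term :: countable by countable_datatype

text \<open>Terms of the hull must form a countable type, so they carry finite lists of parameters;
  padding makes an environment of such a list.\<close>

definition list_env :: "'a \<Rightarrow> 'a list \<Rightarrow> nat \<Rightarrow> 'a" where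
  "list_env z xs i = (if i < length xs then xs ! i else z)"

text \<open>\<open>Base\<close> yields the generators and \<open>Witness\<close> the values of
  Skolem functions. The default \<open>zero M\<close> keeps the hull inside the universe when there
  is no witness.\<close>

primrec hull_val :: "'a struct \<Rightarrow> (int option \<Rightarrow> 'a) \<Rightarrow> hull_term \<Rightarrow> 'a" where
  "hull_val M b (Base k) = b k"
| "hull_val M b (Witness x \<phi> ts) =
    (let e = list_env (zero M) (map (hull_val M b) ts)
     in if \<exists>a\<in>univ M. sat M (e(x := a)) \<phi> then SOME a. a \<in> univ M \<and> sat M (e(x := a)) \<phi> else zero M)"

lemma hull_val_in:
  assumes "zero M \<in> univ M" "range b \<subseteq> univ M"
  shows "hull_val M b t \<in> univ M"
proof (cases t)
  case (Witness x \<phi> ts)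
  define e where "e = list_env (zero M) (map (hull_val M b) ts)"
  have "(SOME a. a \<in> univ M \<and> sat M (e(x := a)) \<phi>) \<in> univ M" if "\<exists>a\<in>univ M. sat M (e(x := a)) \<phi>"
    using someI_ex[of "\<lambda>a. a \<in> univ M \<and> sat M (e(x := a)) \<phi>"] that by blast
  then show ?thesis
    using assms(1) by (simp add: Witness Let_def flip: e_def)
qed (use assms in auto)

text \<open>Only the finitely many free variables of \<phi> matter. Terms for their values, put into
  one list, make a \<open>Witness\<close> term whose value is as required.\<close>

lemma hull_witness:
  assumes e: "range e \<subseteq> range (hull_val M b)" and a: "a \<in> univ M" "sat M (e(x := a)) \<phi>"
  shows "\<exists>a\<in>range (hull_val M b). sat M (e(x := a)) \<phi>"
proof -
  obtain n where n: "fv \<phi> \<subseteq> {..<n}"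
    using finite_nat_iff_bounded finite_fv by blast
  have "\<forall>i. \<exists>t. e i = hull_val M b t"
    using e by auto
  then obtain t where t: "\<And>i. e i = hull_val M b (t i)"
    by metis
  define e' where "e' = list_env (zero M) (map (hull_val M b) (map t [0..<n]))"
  have e': "sat M (e'(x := a)) \<phi> = sat M (e(x := a)) \<phi>" for a
    using n by (intro sat_cong) (auto simp: e'_def list_env_def t)
  then have ex: "\<exists>a. a \<in> univ M \<and> sat M (e'(x := a)) \<phi>"
    using a by auto
  then have "hull_val M b (Witness x \<phi> (map t [0..<n]))
      = (SOME a. a \<in> univ M \<and> sat M (e'(x := a)) \<phi>)"
    by (auto simp: e'_def Let_def simp del: map_map)
  with someI_ex[OF ex] have "sat M (e'(x := hull_val M b (Witness x \<phi> (map t [0..<n])))) \<phi>"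
    by metis
  then show ?thesis
    using e' by blast
qed

section \<open>Elementary substructures, transported to another type\<close>

definition pullback :: "'a struct \<Rightarrow> ('b \<Rightarrow> 'a) \<Rightarrow> 'b struct" where
  "pullback M h = \<lparr>univ = UNIV, lt = (\<lambda>x y. lt M (h x) (h y)),
    add = (\<lambda>x y. inv h (add M (h x) (h y))), mul = (\<lambda>x y. inv h (mul M (h x) (h y))),
    zero = inv h (zero M), one = inv h (one M)\<rparr>"

text \<open>\<open>tarski_vaught\<close> is the Tarski-Vaught test for \<open>range h\<close>. It
  also makes \<open>range h\<close> closed under the operations, which gives sense to
  \<open>inv h\<close> in \<open>pullback\<close>.\<close>

locale elementary_pullback = elementary_extension M \<iota>
  for M :: "'a struct" and \<iota> +
  fixes h :: "'b \<Rightarrow> 'a"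
  assumes inj: "inj h" and range_in: "range h \<subseteq> univ M" and emb_psubset: "range \<iota> \<subset> range h"
    and tarski_vaught: "\<And>e x \<phi> a. range e \<subseteq> range h \<Longrightarrow> a \<in> univ M \<Longrightarrow> sat M (e(x := a)) \<phi>
      \<Longrightarrow> \<exists>a\<in>range h. sat M (e(x := a)) \<phi>"
begin

abbreviation "N \<equiv> pullback M h"
abbreviation "\<iota>' \<equiv> inv h \<circ> \<iota>"

lemma h_in [simp]: "h x \<in> univ M"
  using range_in by auto

text \<open>Each of these elements is the only solution of an equation with parameters in
  \<open>range h\<close>, so the witness that \<open>tarski_vaught\<close> supplies must be that
  element.\<close>

lemma range_closed:
  "zero M \<in> range h" "one M \<in> range h" "add M (h x) (h y) \<in> range h" "mul M (h x) (h y) \<in> range h"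
  using tarski_vaught[of "\<lambda>_. h x" "zero M" 0 "Equal (Var 0) Zero"]
    tarski_vaught[of "\<lambda>_. h x" "one M" 0 "Equal (Var 0) One"]
    tarski_vaught[of "(\<lambda>_. h x)(2 := h y)" "add M (h x) (h y)" 0 "Equal (Var 0) (Add (Var 1) (Var 2))"]
    tarski_vaught[of "(\<lambda>_. h x)(2 := h y)" "mul M (h x) (h y)" 0 "Equal (Var 0) (Mul (Var 1) (Var 2))"]
  by auto

lemma h_pullback [simp]:
  "univ N = UNIV" "lt N x y = lt M (h x) (h y)"
  "h (zero N) = zero M" "h (one N) = one M"
  "h (add N x y) = add M (h x) (h y)" "h (mul N x y) = mul M (h x) (h y)"
  by (simp_all add: pullback_def f_inv_into_f[OF range_closed(1)] f_inv_into_f[OF range_closed(2)]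
      f_inv_into_f[OF range_closed(3)] f_inv_into_f[OF range_closed(4)])

lemma h_emb [simp]: "h (inv h (\<iota> k)) = \<iota> k"
  using emb_psubset by (intro f_inv_into_f) auto

lemma h_tm_val: "h (tm_val N e t) = tm_val M (h \<circ> e) t"
  by (induction t) simp_all

text \<open>Injectivity of \<open>h\<close> settles equations; the Tarski-Vaught test lets a
  quantifier over \<open>range h\<close> range over all of \<open>univ M\<close>.\<close>

lemma sat_pullback: "sat N e \<phi> \<longleftrightarrow> sat M (h \<circ> e) \<phi>"
proof (induction \<phi> arbitrary: e)
  case (Equal t u)
  show ?case
    unfolding sat.simps h_tm_val[symmetric] inj_eq[OF inj] ..
next
  case (Exists x \<phi>)
  have upd: "h \<circ> e(x := a) = (h \<circ> e)(x := h a)" for a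
    by auto
  have "sat N e (Exists x \<phi>) \<longleftrightarrow> (\<exists>a\<in>range h. sat M ((h \<circ> e)(x := a)) \<phi>)"
    unfolding sat.simps h_pullback Exists upd by blast
  also have "\<dots> \<longleftrightarrow> (\<exists>a\<in>univ M. sat M ((h \<circ> e)(x := a)) \<phi>)"
    using tarski_vaught[of "h \<circ> e" _ x \<phi>] range_in image_comp[of h e UNIV] by blast
  also have "\<dots> \<longleftrightarrow> sat M (h \<circ> e) (Exists x \<phi>)"
    by (rule sat.simps(5)[symmetric])
  finally show ?case .
qed (simp_all add: h_tm_val)

sublocale N: elementary_extension N \<iota>'
proof
  obtain c where "h c \<notin> range \<iota>"
    using emb_psubset by auto
  then have "c \<notin> range \<iota>'"
    by auto
  moreover have "sat N (\<iota>' \<circ> e) \<phi> \<longleftrightarrow> sat int_struct e \<phi>" for e \<phi>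
  proof -
    have "h \<circ> (\<iota>' \<circ> e) = \<iota> \<circ> e"
      by auto
    then show ?thesis
      by (simp add: sat_pullback elementary)
  qed
  ultimately show "proper_elementary_extension N \<iota>'"
    by (auto simp: proper_elementary_extension_def is_struct_def)
qed

lemma prime_in_pullback: "prime_in N x \<longleftrightarrow> prime_in M (h x)"
  by (simp add: prime_in_def sat_pullback comp_def)

lemma h_in_range_emb_iff: "h x \<in> range \<iota> \<longleftrightarrow> x \<in> range \<iota>'"
  using inj by (auto simp: image_iff inj_eq) (metis h_emb inj inj_eq)+

lemma h_eq_add_iff: "add M (h x) (\<iota> k) = h y \<longleftrightarrow> add N x (\<iota>' k) = y"
  using inj by (metis comp_apply h_emb h_pullback(5) inj_eq)

lemma follows_anchors_pullback:
  assumes "follows_anchors s N \<iota>' \<omega>"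
  shows "follows_anchors s M \<iota> (h \<omega>)"
proof -
  have *: "\<forall>k. \<exists>\<pi>\<in>univ N - range \<iota>'.
      prime_in N \<pi> \<and> add N (mul N (\<iota>' (anchor_prod s k)) \<pi>) (\<iota>' k) = \<omega>"
    using assms N.follows_anchors_iff[of \<omega> s] by simp
  have "\<exists>\<pi>\<in>univ M - range \<iota>. prime_in M \<pi> \<and> add M (mul M (\<iota> (anchor_prod s k)) \<pi>) (\<iota> k) = h \<omega>" for k
  proof -
    obtain \<pi> where \<pi>: "\<pi> \<notin> range \<iota>'" "prime_in N \<pi>"
      "add N (mul N (\<iota>' (anchor_prod s k)) \<pi>) (\<iota>' k) = \<omega>"
      using * by blast
    then show ?thesis
      by (intro bexI[of _ "h \<pi>"]) (auto simp: h_in_range_emb_iff prime_in_pullback)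
  qed
  then show ?thesis
    by (simp add: follows_anchors_iff)
qed

text \<open>The difference of \<omega> and k exists already in \<open>N\<close>, and by cancellation
  in \<open>M\<close> there is no other, so the galaxy does not leave
  \<open>range h\<close>.\<close>

lemma galaxy_pullback: "galaxy M \<iota> (h \<omega>) = h ` galaxy N \<iota>' \<omega>"
proof -
  have "d \<in> range h" if "d \<in> univ M" "add M d (\<iota> k) = h \<omega>" for d k
  proof -
    obtain d' where "add N d' (\<iota>' k) = \<omega>"
      using N.subtract_exists[of \<omega> "\<iota>' k"] by auto
    then show ?thesis
      using add_cancel[of d "h d'" "\<iota> k"] that by (auto simp flip: h_eq_add_iff)
  qed
  then have "galaxy M \<iota> (h \<omega>) = {d \<in> range h. \<exists>k. add M d (\<iota> k) = h \<omega>}"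
    by (auto simp: galaxy_eq)
  also have "\<dots> = h ` {d. \<exists>k. add M (h d) (\<iota> k) = h \<omega>}"
    by blast
  also have "\<dots> = h ` {d. \<exists>k. add N d (\<iota>' k) = \<omega>}"
    by (simp only: h_eq_add_iff)
  also have "\<dots> = h ` galaxy N \<iota>' \<omega>"
    by (simp add: N.galaxy_eq)
  finally show ?thesis .
qed

lemma galaxy_primes_pullback:
  "{x \<in> galaxy M \<iota> (h \<omega>). prime_in M x} = h ` {x \<in> galaxy N \<iota>' \<omega>. prime_in N x}"
  by (auto simp: galaxy_pullback prime_in_pullback)

end

text \<open>Downward Loewenheim-Skolem: the hull is countable, and infinite because it contains the
  integers, hence in bijection with \<open>nat\<close>.\<close>

lemma countable_pullback_exists:
  fixes M :: "'a struct"
  assumes "proper_elementary_extension M \<iota>"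
  shows "\<exists>h :: nat \<Rightarrow> 'a. elementary_pullback M \<iota> h"
proof -
  interpret elementary_extension M \<iota>
    using assms by unfold_locales
  obtain c where c: "c \<in> univ M" "c \<notin> range \<iota>"
    using extension by (auto simp: proper_elementary_extension_def)
  \<comment> \<open>\<open>None\<close> stands for one element outside the integers, which keeps the
    hull a proper extension.\<close>
  define b where "b = case_option c \<iota>"
  define H where "H = range (hull_val M b)"
  have b: "range b \<subseteq> H"
    unfolding H_def by (metis hull_val.simps(1) image_subsetI rangeI)
  have c_in: "c \<in> H" and emb_in: "range \<iota> \<subseteq> H"
    using b unfolding b_def by (auto split: option.splits dest: subsetD[of _ _ "case_option c \<iota> _"])
  have "infinite (range \<iota>)"
    using finite_imageD[of \<iota> UNIV] by (auto simp: inj_def infinite_UNIV_int)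
  then have "infinite H" "countable H"
    using emb_in finite_subset by (auto simp: H_def)
  then obtain h :: "nat \<Rightarrow> 'a" where h: "bij_betw h UNIV H"
    using bij_betw_from_nat_into by blast
  then have "inj h" and H: "range h = H"
    by (auto simp: bij_betw_def)
  moreover have "H \<subseteq> univ M"
    using c by (auto simp: H_def b_def intro!: hull_val_in split: option.splits)
  moreover have "range \<iota> \<subset> H"
    using emb_in c_in c(2) by blast
  moreover have "\<exists>a\<in>H. sat M (e(x := a)) \<phi>"
    if "range e \<subseteq> H" "a \<in> univ M" "sat M (e(x := a)) \<phi>" for e x \<phi> a
    using that hull_witness unfolding H_def by metis
  ultimately have "elementary_pullback M \<iota> h"
    by unfold_locales (simp_all add: H)
  then show ?thesis
    by blast
qed

text \<open>An \<omega> found in a countable elementary substructure, together with its prime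
  cofactors, still works in \<open>M\<close>.\<close>

lemma good_anchors_of_countable:
  fixes P :: "nat struct \<Rightarrow> (int \<Rightarrow> nat) \<Rightarrow> nat \<Rightarrow> bool"
    and Q :: "'a struct \<Rightarrow> (int \<Rightarrow> 'a) \<Rightarrow> 'a \<Rightarrow> bool"
  assumes good: "good_anchors TYPE(nat) P s"
    and transfer: "\<And>M \<iota> h \<omega>. elementary_pullback M \<iota> h \<Longrightarrow> P (pullback M h) (inv h \<circ> \<iota>) \<omega> \<Longrightarrow> Q M \<iota> (h \<omega>)"
  shows "good_anchors TYPE('a) Q s"
  unfolding good_anchors_def
proof (intro conjI allI impI)
  fix M :: "'a struct" and \<iota> assume ext: "proper_elementary_extension M \<iota>"
  obtain h :: "nat \<Rightarrow> 'a" where h: "elementary_pullback M \<iota> h"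
    using countable_pullback_exists[OF ext] by blast
  interpret elementary_pullback M \<iota> h
    by (fact h)
  obtain \<omega> where \<omega>: "\<omega> \<notin> range \<iota>'" "follows_anchors s N \<iota>' \<omega>" "P N \<iota>' \<omega>"
    using good N.extension unfolding good_anchors_def by blast
  then show "\<exists>\<omega>\<in>univ M - range \<iota>. follows_anchors s M \<iota> \<omega> \<and> Q M \<iota> \<omega>"
    using follows_anchors_pullback transfer[OF h]
    by (intro bexI[of _ "h \<omega>"]) (auto simp: h_in_range_emb_iff)
qed (use good in \<open>auto simp: good_anchors_def\<close>)

lemma good_anchors_no_primes_of_countable:
  assumes "good_anchors TYPE(nat) galaxy_no_primes s"
  shows "good_anchors TYPE('a) galaxy_no_primes s"
  using assms
proof (rule good_anchors_of_countable)
  fix M :: "'a struct" and \<iota> and h :: "nat \<Rightarrow> 'a" and \<omega>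
  assume h: "elementary_pullback M \<iota> h" and "galaxy_no_primes (pullback M h) (inv h \<circ> \<iota>) \<omega>"
  interpret elementary_pullback M \<iota> h
    by (fact h)
  show "galaxy_no_primes M \<iota> (h \<omega>)"
    using \<open>galaxy_no_primes N \<iota>' \<omega>\<close> galaxy_primes_pullback[of \<omega>] by (auto simp: galaxy_no_primes_def)
qed

lemma good_anchors_inf_primes_of_countable:
  assumes "good_anchors TYPE(nat) galaxy_inf_primes s"
  shows "good_anchors TYPE('a) galaxy_inf_primes s"
  using assms
proof (rule good_anchors_of_countable)
  fix M :: "'a struct" and \<iota> and h :: "nat \<Rightarrow> 'a" and \<omega>
  assume h: "elementary_pullback M \<iota> h" and "galaxy_inf_primes (pullback M h) (inv h \<circ> \<iota>) \<omega>"
  interpret elementary_pullback M \<iota> h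
    by (fact h)
  show "galaxy_inf_primes M \<iota> (h \<omega>)"
    using \<open>galaxy_inf_primes N \<iota>' \<omega>\<close> galaxy_primes_pullback[of \<omega>] finite_imageD[OF _ inj_on_subset[OF inj]]
    by (auto simp: galaxy_inf_primes_def)
qed

section \<open>Anchors from rational numbers\<close>

text \<open>The assumptions say in turn that \<open>num p / den p\<close> is a p-adic integer, that
  it is not an integer, so that all exponents are finite, and that for each k almost all exponents
  vanish.\<close>

locale rational_anchors =
  fixes num den :: "nat \<Rightarrow> int"
  assumes coprime_den: "prime p \<Longrightarrow> coprime (den p) (int p)"
    and not_integral: "prime p \<Longrightarrow> den p * k \<noteq> num p"
    and finite_divisors: "finite {p. prime p \<and> int p dvd den p * k - num p}"
begin

text \<open>Approximations of the \<open>p\<close>-adic integer \<open>num p / den p\<close>.\<close>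

definition anchor :: anchors where
  "anchor p n = (SOME t. [den p * t = num p] (mod int p ^ n))"

lemma cong_anchor:
  assumes "prime p"
  shows "[den p * anchor p n = num p] (mod int p ^ n)"
proof -
  obtain x where x: "[den p * x = 1] (mod int p ^ n)"
    using cong_solve_coprime_int[of "den p" "int p ^ n"] coprime_den[OF assms] by auto
  then have "[den p * (x * num p) = num p] (mod int p ^ n)"
    using cong_mult[OF x cong_refl[of "num p"]] by (simp add: mult.assoc)
  then show ?thesis
    unfolding anchor_def by (rule someI)
qed

lemma cong_anchor_iff:
  assumes "prime p"
  shows "[k = anchor p n] (mod int p ^ n) \<longleftrightarrow> int p ^ n dvd den p * k - num p"
proof -
  have "[k = anchor p n] (mod int p ^ n) \<longleftrightarrow> [den p * k = den p * anchor p n] (mod int p ^ n)"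
    using coprime_den[OF assms] by (simp add: cong_mult_lcancel)
  also have "\<dots> \<longleftrightarrow> [den p * k = num p] (mod int p ^ n)"
    using cong_anchor[OF assms] cong_trans cong_sym by blast
  finally show ?thesis
    by (simp add: cong_iff_dvd_diff)
qed

lemma power_dvd_iff:
  assumes "prime p"
  shows "int p ^ n dvd den p * k - num p \<longleftrightarrow> n \<le> multiplicity (int p) (den p * k - num p)"
  using not_integral[OF assms] assms
  by (intro power_dvd_iff_le_multiplicity) (auto simp: not_prime_unit)

lemma anchor_exp_anchor:
  assumes "prime p"
  shows "anchor_exp anchor p k = multiplicity (int p) (den p * k - num p)"
  unfolding anchor_exp_def cong_anchor_iff[OF assms] power_dvd_iff[OF assms]
  by (rule Greatest_equality) simp_all

lemma admissible_anchor: "admissible anchor"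
  unfolding admissible_def
proof (intro allI impI)
  fix p :: nat and k assume p: "prime p"
  show "\<exists>n. [k = anchor p n] (mod int p ^ n) \<and>
      (\<forall>m. [k = anchor p m] (mod int p ^ m) \<longrightarrow> m \<le> n)"
    unfolding cong_anchor_iff[OF p] power_dvd_iff[OF p] by (rule exI, rule conjI[OF order_refl]) simp
qed

lemma exponents_eventually_zero_anchor: "exponents_eventually_zero anchor"
  unfolding exponents_eventually_zero_def
proof
  fix k
  obtain N where N: "\<And>p. prime p \<Longrightarrow> int p dvd den p * k - num p \<Longrightarrow> p \<le> N"
    using finite_divisors[of k] unfolding finite_nat_set_iff_bounded_le by blast
  have "anchor_exp anchor p k = 0" if "p > N" "prime p" for p
  proof -
    have "\<not> int p dvd den p * k - num p"
      using N[OF that(2)] that(1) by linarith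
    then show ?thesis
      unfolding anchor_exp_anchor[OF that(2)] by (rule not_dvd_imp_multiplicity_0)
  qed
  then show "\<exists>N. \<forall>p>N. prime p \<longrightarrow> anchor_exp anchor p k = 0"
    by blast
qed

section \<open>Prime factorization of a_k\<close>

lemma anchor_prod_pos: "anchor_prod anchor k > 0"
  unfolding anchor_prod_def by (intro prod_pos) (auto simp: prime_gt_0_nat)

lemma multiplicity_anchor_prod:
  assumes "prime p"
  shows "multiplicity (int p) (anchor_prod anchor k) = multiplicity (int p) (den p * k - num p)"
proof -
  let ?e = "\<lambda>q. anchor_exp anchor q k"
  let ?S = "{q. prime q \<and> ?e q \<noteq> 0}"
  have "?S \<subseteq> {q. prime q \<and> int q dvd den q * k - num q}"
    by (auto simp: anchor_exp_anchor) (metis less_irrefl not_dvd_imp_multiplicity_0)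
  then have fin: "finite ?S"
    using finite_divisors finite_subset by blast
  have "multiplicity (int p) (anchor_prod anchor k) = (\<Sum>q\<in>?S. multiplicity (int p) (int q ^ ?e q))"
    unfolding anchor_prod_def using assms fin
    by (intro prime_elem_multiplicity_prod_distrib) auto
  also have "\<dots> = (\<Sum>q\<in>?S. if q = p then ?e p else 0)"
    using assms by (intro sum.cong) (auto simp: multiplicity_distinct_prime_power)
  also have "\<dots> = ?e p"
    using fin assms by simp
  finally show ?thesis
    using assms by (simp add: anchor_exp_anchor)
qed

text \<open>A positive integer is determined by its multiplicities at the primes; this lets a
  first-order formula single out a_k.\<close>

lemma anchor_prod_eqI:
  assumes "a > 0" "\<And>p. prime p \<Longrightarrow> multiplicity (int p) a = multiplicity (int p) (den p * k - num p)"
  shows "a = anchor_prod anchor k"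
proof -
  have "multiplicity p a = multiplicity p (anchor_prod anchor k)" if "prime p" for p :: int
    using assms(2)[of "nat p"] multiplicity_anchor_prod[of "nat p" k] that prime_ge_0_int[of p]
    by simp
  then have "normalize a = normalize (anchor_prod anchor k)"
    using assms(1) anchor_prod_pos[of k] by (intro multiplicity_eq_imp_eq) auto
  then show ?thesis
    using assms(1) anchor_prod_pos[of k] by simp
qed

lemma anchor_prod_eq_1_iff:
  "anchor_prod anchor k = 1 \<longleftrightarrow> (\<forall>p. prime p \<longrightarrow> \<not> int p dvd den p * k - num p)"
proof
  assume 1: "anchor_prod anchor k = 1"
  have "multiplicity (int p) (den p * k - num p) = 0" if "prime p" for p
    using multiplicity_anchor_prod[OF that, of k] 1 by simp
  then show "\<forall>p. prime p \<longrightarrow> \<not> int p dvd den p * k - num p"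
    using power_dvd_iff[of _ 1 k] by simp
next
  assume *: "\<forall>p. prime p \<longrightarrow> \<not> int p dvd den p * k - num p"
  have "1 = anchor_prod anchor k"
    by (rule anchor_prod_eqI) (use * in \<open>simp_all add: not_dvd_imp_multiplicity_0\<close>)
  then show "anchor_prod anchor k = 1" ..
qed

section \<open>Application of Dickson's conjecture\<close>

text \<open>The forms to which Dickson's conjecture is applied are \<open>(x\<^sub>0 + Q m - k) / a\<^sub>k\<close>,
  where \<open>x\<^sub>0\<close> is close to the anchors at the finitely many primes dividing \<open>Q\<close>.\<close>

lemma Dickson_imp_solution:
  assumes Dickson: "Dickson_Conjecture"
  shows "\<exists>x>N. \<forall>k. - N < k \<and> k < N \<longrightarrow>
    (\<exists>\<pi>. prime \<pi> \<and> \<pi> > N \<and> x = anchor_prod anchor k * \<pi> + k)"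
proof -
  \<comment> \<open>The map \<kappa> enumerates -n, ..., n as i runs from 1 to l. For negative
    \<open>N\<close> this leaves the single value 0, so that l is at least 1 in every case.\<close>
  define n where "n = nat N"
  define l where "l = 2 * n + 1"
  define \<kappa> where "\<kappa> i = int i - int n - 1" for i :: nat
  define a where "a i = anchor_prod anchor (\<kappa> i)" for i
  define v where "v p i = multiplicity (int p) (den p * \<kappa> i - num p)" for p i
  \<comment> \<open>The primes up to \<open>l\<close> are included so that a prime outside
    \<open>P\<close> exceeds the number of forms.\<close>
  define P where "P = {p. prime p \<and> p \<le> l} \<union>
    (\<Union>i\<in>{1..l}. {p. prime p \<and> int p dvd den p * \<kappa> i - num p})"
  \<comment> \<open>An exponent beyond all \<open>v p i\<close>, so that x0 modulo p^E decides the
    exact power of p in each x0 - \<kappa> i.\<close>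
  define E where "E = Suc (\<Sum>p\<in>P. \<Sum>i\<in>{1..l}. v p i)"
  define Q where "Q = (\<Prod>p\<in>P. int p ^ E)"
  have P: "finite P" "\<And>p. p \<in> P \<Longrightarrow> prime p"
    unfolding P_def using finite_divisors by auto
  have v_less: "v p i < E" if "p \<in> P" "i \<in> {1..l}" for p i
  proof -
    have "v p i \<le> (\<Sum>i\<in>{1..l}. v p i)"
      using that by (intro member_le_sum) auto
    also have "\<dots> \<le> (\<Sum>p\<in>P. \<Sum>i\<in>{1..l}. v p i)"
      using that P by (intro member_le_sum) auto
    finally show ?thesis
      by (simp add: E_def)
  qed
  \<comment> \<open>The Chinese remainder theorem is applied to naturals, so the possibly negative
    anchors are replaced by their residues.\<close>
  have "\<exists>x. \<forall>p\<in>P. [x = nat (anchor p E mod int p ^ E)] (mod p ^ E)"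
    using P by (intro chinese_remainder_nat) (auto simp: primes_coprime)
  then obtain x0 where x0: "\<And>p. p \<in> P \<Longrightarrow> [x0 = nat (anchor p E mod int p ^ E)] (mod p ^ E)"
    by blast
  have x0_cong: "int p ^ E dvd den p * int x0 - num p" if "p \<in> P" for p
  proof -
    have "[int x0 = int (nat (anchor p E mod int p ^ E))] (mod int (p ^ E))"
      using x0[OF that] by (simp only: cong_int_iff)
    also have "int (nat (anchor p E mod int p ^ E)) = anchor p E mod int p ^ E"
      using P(2)[OF that] by (simp add: prime_gt_0_nat)
    finally have "[int x0 = anchor p E] (mod int p ^ E)"
      by (simp add: cong_def)
    then show ?thesis
      using cong_anchor_iff[OF P(2)[OF that]] by blast
  qed
  have a_pos: "a i > 0" for i
    by (simp add: a_def anchor_prod_pos)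
  have mult_a: "multiplicity (int p) (a i) = v p i" if "prime p" for p i
    using multiplicity_anchor_prod[OF that] by (simp add: a_def v_def)
  \<comment> \<open>Modulo p^E, \<open>den p\<close> times x0 - \<kappa> i is the negative of
    \<open>den p * \<kappa> i - num p\<close>, and \<open>den p\<close> is invertible.\<close>
  have dvd_shift_iff: "int p ^ j dvd int x0 - \<kappa> i \<longleftrightarrow> j \<le> v p i" if "p \<in> P" "j \<le> E" for p i j
  proof -
    have "int p ^ j dvd den p * int x0 - num p"
      using x0_cong[OF that(1)] le_imp_power_dvd[OF that(2)] dvd_trans by blast
    moreover have "den p * (int x0 - \<kappa> i) = (den p * int x0 - num p) - (den p * \<kappa> i - num p)"
      by (simp add: algebra_simps)
    ultimately have "int p ^ j dvd den p * (int x0 - \<kappa> i) \<longleftrightarrow> int p ^ j dvd den p * \<kappa> i - num p"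
      by (metis dvd_diff_right_iff)
    moreover have "coprime (int p ^ j) (den p)"
      using coprime_den[OF P(2)[OF that(1)]] by (simp add: coprime_commute)
    ultimately show ?thesis
      using power_dvd_iff[OF P(2)[OF that(1)]] by (simp add: v_def coprime_dvd_mult_right_iff)
  qed
  have v_zero: "v p i = 0" if "prime p" "p \<notin> P" "i \<in> {1..l}" for p i
    using that by (auto simp: v_def P_def intro: not_dvd_imp_multiplicity_0)
  have a_dvd: "a i dvd y" if "i \<in> {1..l}" "\<And>p. p \<in> P \<Longrightarrow> int p ^ v p i dvd y" for i y
  proof (cases "y = 0")
    case False
    show ?thesis
    proof (rule multiplicity_le_imp_dvd)
      fix q :: int assume q: "prime q"
      then obtain p where p: "q = int p" "prime p"
        by (metis prime_int_nat_transfer prime_ge_0_int nat_0_le)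
      show "multiplicity q (a i) \<le> multiplicity q y"
      proof (cases "p \<in> P")
        case True
        then show ?thesis
          using that(2)[OF True] mult_a[OF p(2)] False q p by (auto intro!: multiplicity_geI)
      qed (use mult_a v_zero p that in simp)
    qed (use a_pos[of i] in simp)
  qed simp
  have a_dvd_shift: "a i dvd int x0 - \<kappa> i" if "i \<in> {1..l}" for i
    using a_dvd[OF that] dvd_shift_iff v_less[OF _ that] by (metis less_imp_le order_refl)
  have a_dvd_Q: "a i dvd Q" if "i \<in> {1..l}" for i
  proof (rule a_dvd[OF that])
    fix p assume p: "p \<in> P"
    have "int p ^ v p i dvd int p ^ E"
      using v_less[OF p that] by (intro le_imp_power_dvd) simp
    also have "\<dots> dvd Q"
      unfolding Q_def using p P by (intro dvd_prodI) auto
    finally show "int p ^ v p i dvd Q" .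
  qed
  have Q_pos: "Q > 0"
    unfolding Q_def using P by (intro prod_pos) (auto simp: prime_gt_0_nat)
  define b where "b i = Q div a i" for i
  define c where "c i = (int x0 - \<kappa> i) div a i" for i
  have form: "a i * (c i + b i * m) = int x0 + Q * m - \<kappa> i" if "i \<in> {1..l}" for i m
    using a_dvd_Q[OF that] a_dvd_shift[OF that] by (simp add: b_def c_def distrib_left flip: mult.assoc)
  have b_pos: "b i \<ge> 1" if "i \<in> {1..l}" for i
  proof -
    have "a i * b i > 0"
      using a_dvd_Q[OF that] Q_pos by (simp add: b_def)
    then show ?thesis
      using a_pos[of i] by (simp add: zero_less_mult_iff)
  qed
  have no_divisor: "\<not> (\<forall>m. int p dvd (\<Prod>i=1..l. c i + b i * m))" if p: "prime p" for p
  proof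
    assume dvd: "\<forall>m. int p dvd (\<Prod>i=1..l. c i + b i * m)"
    have "\<exists>m. \<forall>i\<in>{1..l}. \<not> int p dvd c i + b i * m"
    proof (cases "p \<in> P")
      case True
      \<comment> \<open>Here m = 0 works: otherwise p would divide x0 - \<kappa> i to the power
        \<open>Suc (v p i)\<close>, which is still at most \<open>E\<close>.\<close>
      have "\<not> int p dvd c i + b i * 0" if "i \<in> {1..l}" for i
      proof
        assume "int p dvd c i + b i * 0"
        moreover have "int p ^ v p i dvd a i"
          using mult_a[OF p] multiplicity_dvd by metis
        ultimately have "int p ^ v p i * int p dvd a i * (c i + b i * 0)"
          by (rule mult_dvd_mono[rotated])
        then have "int p ^ Suc (v p i) dvd int x0 - \<kappa> i"
          using form[OF that, of 0] by (simp add: mult.commute)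
        then show False
          using dvd_shift_iff[OF True, of "Suc (v p i)" i] v_less[OF True that] by simp
      qed
      then show ?thesis by blast
    next
      case False
      then have "p > l"
        using p by (auto simp: P_def)
      have "coprime (int q ^ E) (int p)" if "q \<in> P" for q
        using primes_coprime[OF P(2)[OF that] p] that False by auto
      then have "coprime Q (int p)"
        unfolding Q_def by (rule prod_coprime_left)
      then obtain t where "[Q * t = 1] (mod int p)"
        using cong_solve_coprime_int by blast
      \<comment> \<open>As Q is invertible modulo p, some m makes x0 + Q m congruent to w = n + 1.
        The differences w - \<kappa> i then lie between 1 and l < p, so p divides none of
        them.\<close>
      define w where "w = int n + 1"
      have "[Q * t * (w - int x0) = 1 * (w - int x0)] (mod int p)"
        by (intro cong_mult \<open>[Q * t = 1] (mod int p)\<close> cong_refl)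
      then have w: "int p dvd Q * t * (w - int x0) - (w - int x0)"
        by (simp add: cong_iff_dvd_diff)
      have "\<not> int p dvd c i + b i * (t * (w - int x0))" if "i \<in> {1..l}" for i
      proof
        assume "int p dvd c i + b i * (t * (w - int x0))"
        then have "int p dvd int x0 + Q * (t * (w - int x0)) - \<kappa> i"
          using form[OF that] by (metis dvd_mult)
        then have "int p dvd (int x0 + Q * (t * (w - int x0)) - \<kappa> i) -
            (Q * t * (w - int x0) - (w - int x0))"
          using w by (rule dvd_diff)
        also have "\<dots> = w - \<kappa> i"
          by (simp add: algebra_simps)
        finally have "int p dvd w - \<kappa> i" .
        moreover have "0 < w - \<kappa> i" "w - \<kappa> i < int p"
          using that \<open>p > l\<close> by (auto simp: w_def \<kappa>_def l_def)
        ultimately show False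
          using zdvd_not_zless by blast
      qed
      then show ?thesis by blast
    qed
    then obtain m where m: "\<forall>i\<in>{1..l}. \<not> int p dvd c i + b i * m" ..
    have "prime (int p)"
      using p by simp
    then have "\<not> int p dvd (\<Prod>i\<in>{1..l}. c i + b i * m)"
      using m by (subst prime_dvd_prod_iff) simp_all
    then show False
      using dvd by blast
  qed
  have "\<not> (\<exists>d::int. d > 1 \<and> (\<forall>m::int. d dvd (\<Prod>i=1..l. c i + b i * m)))"
  proof
    assume "\<exists>d::int. d > 1 \<and> (\<forall>m::int. d dvd (\<Prod>i=1..l. c i + b i * m))"
    then obtain d :: int where d: "d > 1" "\<forall>m. d dvd (\<Prod>i=1..l. c i + b i * m)"
      by blast
    obtain q where "prime q" "q dvd d"
      using d(1) prime_factor_int[of d] by auto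
    then obtain p where "int p dvd d" "prime p"
      by (metis prime_int_nat_transfer prime_ge_0_int nat_0_le)
    then show False
      using no_divisor d(2) dvd_trans by blast
  qed
  then have "infinite {m::nat. \<forall>i\<in>{1..l}. prime (c i + b i * int m)}"
    using Dickson b_pos unfolding Dickson_Conjecture_def by (simp add: l_def)
  \<comment> \<open>As b i and Q are at least 1, this lower bound on m pushes all the primes, and x0
    + Q m as well, beyond \<open>N\<close>.\<close>
  then obtain m where m: "m > n + nat (\<Sum>i\<in>{1..l}. \<bar>c i\<bar>)"
      and primes: "\<forall>i\<in>{1..l}. prime (c i + b i * int m)"
    unfolding infinite_nat_iff_unbounded by blast
  have large: "c i + b i * int m > N" if "i \<in> {1..l}" for i
  proof -
    have "\<bar>c i\<bar> \<le> (\<Sum>i\<in>{1..l}. \<bar>c i\<bar>)"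
      using that by (intro member_le_sum) auto
    then have "int m > N - c i"
      using m by (simp add: n_def)
    moreover have "1 * int m \<le> b i * int m"
      using b_pos[OF that] by (intro mult_right_mono) simp_all
    ultimately show ?thesis by simp
  qed
  have "int m \<le> Q * int m"
    using mult_right_mono[of 1 Q "int m"] Q_pos by simp
  moreover have "N < int m"
    using m by (simp add: n_def)
  ultimately have "int x0 + Q * int m > N"
    by linarith
  moreover have "\<exists>\<pi>. prime \<pi> \<and> \<pi> > N \<and> int x0 + Q * int m = anchor_prod anchor k * \<pi> + k"
    if k: "- N < k" "k < N" for k
  proof -
    define i where "i = nat (k + int n + 1)"
    have i: "i \<in> {1..l}" "\<kappa> i = k"
      using k by (auto simp: i_def l_def \<kappa>_def n_def)
    then show ?thesis
      using primes large[OF i(1)] form[OF i(1), of "int m"]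
      by (intro exI[of _ "c i + b i * int m"]) (simp add: a_def)
  qed
  ultimately show ?thesis
    by blast
qed

end

section \<open>Overspill\<close>

definition divides_fm :: "nat \<Rightarrow> nat \<Rightarrow> fm" where
  "divides_fm i j = Exists 7 (Equal (Mul (Var i) (Var 7)) (Var j))"

text \<open>Variable 7 is reserved for the bound quotient, whence the side conditions.\<close>

lemma sat_divides_fm [simp]: "i \<noteq> 7 \<Longrightarrow> j \<noteq> 7 \<Longrightarrow> sat int_struct e (divides_fm i j) \<longleftrightarrow> e i dvd e j"
  unfolding dvd_def by (simp add: divides_fm_def) (rule ex_cong1, rule eq_commute)

lemma fv_divides_fm [simp]: "fv (divides_fm i j) = {i, j} - {7}"
  by (auto simp: divides_fm_def)

lemma fv_prime_fm [simp]: "fv prime_fm = {0}"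
  by (auto simp: prime_fm_def)

text \<open>\<open>Var 1\<close> is a power of the prime \<open>Var 0\<close>.\<close>

definition prime_power_fm :: fm where
  "prime_power_fm = Conj (Less Zero (Var 1))
    (Forall 2 (Imp (Conj (Less One (Var 2)) (divides_fm 2 1)) (divides_fm 0 2)))"

lemma fv_prime_power_fm [simp]: "fv prime_power_fm = {0, 1}"
  by (auto simp: prime_power_fm_def)

text \<open>Expresses powers of p without exponentiation. After the p-part of q is split off, a
  cofactor above 1 would be a divisor of q not divisible by p.\<close>

lemma prime_power_int_iff:
  fixes p q :: int
  assumes "prime p"
  shows "q > 0 \<and> (\<forall>d>1. d dvd q \<longrightarrow> p dvd d) \<longleftrightarrow> (\<exists>n. q = p ^ n)"
proof
  assume q: "q > 0 \<and> (\<forall>d>1. d dvd q \<longrightarrow> p dvd d)"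
  then have "q \<noteq> 0" "\<not> is_unit p"
    using assms by (auto simp: not_prime_unit)
  then obtain y where y: "q = p ^ multiplicity p q * y" "\<not> p dvd y"
    using multiplicity_decompose' by blast
  have "y > 0"
    using q y(1) assms prime_gt_0_int[of p] by (metis zero_less_mult_pos zero_less_power)
  moreover have "\<not> y > 1"
    using q y by (metis dvd_triv_right)
  ultimately have "y = 1"
    by simp
  then show "\<exists>n. q = p ^ n"
    using y(1) by auto
next
  assume "\<exists>n. q = p ^ n"
  then obtain n where n: "q = p ^ n" ..
  have "p dvd d" if "d > 1" "d dvd q" for d
  proof -
    have "\<bar>d\<bar> \<noteq> 1"
      using that(1) by simp
    then obtain r where r: "prime r" "r dvd d"
      by (rule prime_factor_int)
    then have "r dvd p"
      using n that(2) by (metis dvd_trans prime_dvd_power)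
    then have "r = p"
      using r(1) assms by (simp add: primes_dvd_imp_eq)
    then show ?thesis
      using r(2) by simp
  qed
  then show "q > 0 \<and> (\<forall>d>1. d dvd q \<longrightarrow> p dvd d)"
    using n assms by (simp add: prime_gt_0_int)
qed

lemma sat_prime_power_fm:
  "prime (e 0) \<Longrightarrow> sat int_struct e prime_power_fm \<longleftrightarrow> (\<exists>n. e 1 = e 0 ^ n)"
  by (simp add: prime_power_fm_def flip: prime_power_int_iff)

text \<open>\<open>dvd_fm\<close> says that \<open>Var 1\<close> divides \<open>den p * k - num p\<close>, where \<open>p\<close> is \<open>Var 0\<close>
  and \<open>k\<close> is \<open>Var 3\<close>.\<close>

locale definable_rational_anchors = rational_anchors +
  fixes dvd_fm :: fm
  assumes fv_dvd_fm: "fv dvd_fm \<subseteq> {0, 1, 3}"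
    and sat_dvd_fm: "prime p \<Longrightarrow> e 0 = int p \<Longrightarrow>
      sat int_struct e dvd_fm \<longleftrightarrow> e 1 dvd den p * e 3 - num p"
begin

text \<open>\<open>Var 4\<close> is \<open>a\<^sub>k\<close>: a prime power divides \<open>a\<^sub>k\<close> just if it divides \<open>den p * k - num p\<close>.\<close>

definition anchor_prod_fm :: fm where
  "anchor_prod_fm = Conj (Less Zero (Var 4)) (Forall 0 (Imp prime_fm (Forall 1 (Imp prime_power_fm
    (Conj (Imp (divides_fm 1 4) dvd_fm) (Imp dvd_fm (divides_fm 1 4)))))))"

lemma fv_anchor_prod_fm: "fv anchor_prod_fm \<subseteq> {3, 4}"
  using fv_dvd_fm by (auto simp: anchor_prod_fm_def)

text \<open>Divisibility by the same prime powers means equal multiplicities. \<open>?S\<close>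
  speaks of integer primes, as formulas must; \<open>?R\<close> of natural ones, the arguments of
  \<open>num\<close> and \<open>den\<close>.\<close>

lemma sat_anchor_prod_fm:
  "sat int_struct e anchor_prod_fm \<longleftrightarrow> e 4 = anchor_prod anchor (e 3)"
proof -
  have "sat int_struct e anchor_prod_fm \<longleftrightarrow> e 4 > 0 \<and> (\<forall>p. prime p \<longrightarrow>
      (\<forall>n. int p ^ n dvd e 4 \<longleftrightarrow> int p ^ n dvd den p * e 3 - num p))" (is "_ \<longleftrightarrow> _ \<and> ?R")
  proof -
    have "sat int_struct e anchor_prod_fm \<longleftrightarrow> e 4 > 0 \<and> (\<forall>p::int. prime p \<longrightarrow>
        (\<forall>q n. q = p ^ n \<longrightarrow> (q dvd e 4 \<longleftrightarrow> q dvd den (nat p) * e 3 - num (nat p))))" (is "_ \<longleftrightarrow> _ \<and> ?S")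
    proof -
      have "sat int_struct (e(0 := p, 1 := q)) dvd_fm \<longleftrightarrow> q dvd den (nat p) * e 3 - num (nat p)"
        if "prime p" for p q
        using sat_dvd_fm[of "nat p" "e(0 := p, 1 := q)"] that by (simp add: prime_ge_0_int)
      then show ?thesis
        by (simp add: anchor_prod_fm_def sat_prime_power_fm) blast
    qed
    moreover have "?S \<longleftrightarrow> ?R"
    proof
      assume S: ?S
      show ?R
      proof (intro allI impI)
        fix p n assume "prime (p :: nat)"
        then show "int p ^ n dvd e 4 \<longleftrightarrow> int p ^ n dvd den p * e 3 - num p"
          using S[rule_format, of "int p" _ n] by simp
      qed
    next
      assume R: ?R
      show ?S
      proof (intro allI impI)
        fix p q n assume "prime (p :: int)" "q = p ^ n"
        then show "q dvd e 4 \<longleftrightarrow> q dvd den (nat p) * e 3 - num (nat p)"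
          using R[rule_format, of "nat p" n] by (simp add: prime_ge_0_int)
      qed
    qed
    ultimately show ?thesis
      by simp
  qed
  also have "\<dots> \<longleftrightarrow> e 4 = anchor_prod anchor (e 3)"
  proof
    assume R: "e 4 > 0 \<and> ?R"
    show "e 4 = anchor_prod anchor (e 3)"
    proof (rule anchor_prod_eqI)
      fix p assume p: "prime (p :: nat)"
      have "int p ^ n dvd e 4 \<longleftrightarrow> n \<le> multiplicity (int p) (den p * e 3 - num p)" for n
        using R p power_dvd_iff[OF p] by blast
      then show "multiplicity (int p) (e 4) = multiplicity (int p) (den p * e 3 - num p)"
        by (intro multiplicity_eqI) (simp_all del: power_Suc)
    qed (use R in simp)
  next
    assume e: "e 4 = anchor_prod anchor (e 3)"
    have "int p ^ n dvd e 4 \<longleftrightarrow> int p ^ n dvd den p * e 3 - num p" if p: "prime p" for p n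
    proof -
      have "int p ^ n dvd e 4 \<longleftrightarrow> n \<le> multiplicity (int p) (e 4)"
        using e anchor_prod_pos[of "e 3"] p
        by (intro power_dvd_iff_le_multiplicity) (auto simp: not_prime_unit)
      then show ?thesis
        unfolding power_dvd_iff[OF p] e multiplicity_anchor_prod[OF p] .
    qed
    then show "e 4 > 0 \<and> ?R"
      using e anchor_prod_pos by simp
  qed
  finally show ?thesis .
qed

text \<open>Instance of Dickson's conjecture for all \<open>k = Var 3\<close> with \<open>\<bar>k\<bar> < N = Var 5\<close>, where \<open>Var 6\<close>
  is \<open>x\<close>, \<open>Var 4\<close> is \<open>a\<^sub>k\<close> and \<open>Var 0\<close> is the prime.\<close>

definition solution_fm :: fm where
  "solution_fm = Conj (Less (Var 5) (Var 6))
    (Forall 3 (Imp (Conj (Less Zero (Add (Var 5) (Var 3))) (Less (Var 3) (Var 5)))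
      (Exists 4 (Exists 0 (Conj (Conj anchor_prod_fm prime_fm) (Conj (Less (Var 5) (Var 0))
        (Equal (Var 6) (Add (Mul (Var 4) (Var 0)) (Var 3)))))))))"

section \<open>Transfer to an unlimited bound\<close>

lemma sat_solution_fm:
  assumes "Dickson_Conjecture"
  shows "sat int_struct e (Forall 5 (Exists 6 solution_fm))"
proof -
  have "\<exists>x. sat int_struct (e(5 := N, 6 := x)) solution_fm" for N
  proof -
    obtain x where "x > N" "\<forall>k. - N < k \<and> k < N \<longrightarrow>
        (\<exists>\<pi>. prime \<pi> \<and> \<pi> > N \<and> x = anchor_prod anchor k * \<pi> + k)"
      using Dickson_imp_solution[OF assms] by blast
    then have "sat int_struct (e(5 := N, 6 := x)) solution_fm"
      by (simp add: solution_fm_def sat_anchor_prod_fm)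
    then show ?thesis ..
  qed
  then show ?thesis
    by simp
qed

text \<open>The transferred sentence is evaluated at an unlimited \<open>N\<close>: every integer k
  then satisfies |k| < N, and primes beyond \<open>N\<close> are unlimited.\<close>

lemma follows_anchor_exists:
  assumes "Dickson_Conjecture" "proper_elementary_extension M \<iota>"
  shows "\<exists>\<omega>\<in>univ M - range \<iota>. follows_anchors anchor M \<iota> \<omega>"
proof -
  interpret elementary_extension M \<iota>
    using assms(2) by unfold_locales
  obtain N where N: "N \<in> univ M" "\<And>n. lt M (\<iota> n) N"
    using unlimited_exists by blast
  let ?e = "\<iota> \<circ> (\<lambda>_. 0)"
  have "sat M ?e (Forall 5 (Exists 6 solution_fm))"
    using sat_solution_fm[OF assms(1)] by (rule transfer_true)
  then obtain \<omega> where \<omega>: "\<omega> \<in> univ M" "sat M (?e(5 := N, 6 := \<omega>)) solution_fm"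
    using N(1) by auto
  have trans: "sat M ?e (Forall 0 (Forall 1 (Forall 2
      (Imp (Conj (Less (Var 0) (Var 1)) (Less (Var 1) (Var 2))) (Less (Var 0) (Var 2))))))"
    by (rule transfer_true) auto
  have lt_trans: "lt M x z"
    if "lt M x y" "lt M y z" "x \<in> univ M" "y \<in> univ M" "z \<in> univ M" for x y z
    using trans[simplified] that by blast
  have unlimited: "x \<notin> range \<iota>" if "lt M N x" for x
  proof
    assume "x \<in> range \<iota>"
    then obtain n where n: "x = \<iota> n"
      by blast
    then have "lt M (\<iota> n) (\<iota> n)"
      using lt_trans[OF N(2)[of n], of "\<iota> n"] that N(1) by simp
    then show False
      by simp
  qed
  have "\<exists>\<pi>\<in>univ M - range \<iota>. prime_in M \<pi> \<and>
      add M (mul M (\<iota> (anchor_prod anchor k)) \<pi>) (\<iota> k) = \<omega>" for k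
  proof -
    have "sat M (\<iota> \<circ> (\<lambda>_. k)(1 := - k)) (Forall 5 (Imp (Less (Var 1) (Var 5)) (Less Zero (Add (Var 5) (Var 0)))))"
      unfolding elementary by simp
    then have "lt M (zero M) (add M N (\<iota> k))"
      using N by simp
    then obtain a \<pi> where a: "a \<in> univ M" and \<pi>: "\<pi> \<in> univ M" "lt M N \<pi>"
      and sat: "sat M (?e(5 := N, 6 := \<omega>, 3 := \<iota> k, 4 := a, 0 := \<pi>)) anchor_prod_fm"
        "sat M (?e(5 := N, 6 := \<omega>, 3 := \<iota> k, 4 := a, 0 := \<pi>)) prime_fm"
      and eq: "\<omega> = add M (mul M a \<pi>) (\<iota> k)"
      using \<omega>(2) N(2)[of k] unfolding solution_fm_def by auto
    \<comment> \<open>Transfer at the integer k: in \<open>M\<close> too, a_k is the only solution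
      of \<open>anchor_prod_fm\<close>. Variable 5 now names a_k instead of \<open>N\<close>, as
      that formula speaks only of variables 3 and 4.\<close>
    have "sat M (\<iota> \<circ> (\<lambda>_. k)(5 := anchor_prod anchor k))
        (Forall 4 (Imp anchor_prod_fm (Equal (Var 4) (Var 5))))"
      unfolding elementary by (simp add: sat_anchor_prod_fm)
    moreover have "sat M ((\<iota> \<circ> (\<lambda>_. k)(5 := anchor_prod anchor k))(4 := a)) anchor_prod_fm \<longleftrightarrow>
        sat M (?e(5 := N, 6 := \<omega>, 3 := \<iota> k, 4 := a, 0 := \<pi>)) anchor_prod_fm"
      using fv_anchor_prod_fm by (intro sat_cong) auto
    ultimately have "a = \<iota> (anchor_prod anchor k)"
      using sat(1) a by simp
    moreover have "prime_in M \<pi>"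
      using sat(2) \<pi>(1) by (simp add: sat_prime_fm_iff_prime_in)
    ultimately show ?thesis
      using \<pi> unlimited eq by auto
  qed
  moreover have "lt M N \<omega>"
    using \<omega>(2) by (simp add: solution_fm_def)
  ultimately show ?thesis
    using \<omega>(1) unlimited by (intro bexI[of _ \<omega>]) (simp_all add: follows_anchors_iff)
qed

lemma good_anchors_anchorI:
  assumes "Dickson_Conjecture"
    and "\<And>M \<iota> \<omega>. elementary_extension M \<iota> \<Longrightarrow> \<omega> \<in> univ M \<Longrightarrow> follows_anchors anchor M \<iota> \<omega> \<Longrightarrow> P M \<iota> \<omega>"
  shows "good_anchors TYPE('a) P anchor"
  unfolding good_anchors_def
proof (intro conjI allI impI)
  fix M :: "'a struct" and \<iota> assume ext: "proper_elementary_extension M \<iota>"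
  obtain \<omega> where "\<omega> \<in> univ M - range \<iota>" "follows_anchors anchor M \<iota> \<omega>"
    using follows_anchor_exists[OF assms(1) ext] by blast
  moreover from this have "P M \<iota> \<omega>"
    using assms(2)[OF elementary_extension.intro[OF ext], of \<omega>] by simp
  ultimately show "\<exists>\<omega>\<in>univ M - range \<iota>. follows_anchors anchor M \<iota> \<omega> \<and> P M \<iota> \<omega>"
    by blast
qed (simp_all add: admissible_anchor exponents_eventually_zero_anchor)

end

section \<open>The two choices of anchors\<close>

primrec numeral_tm :: "nat \<Rightarrow> tm" where
  "numeral_tm 0 = Zero"
| "numeral_tm (Suc n) = Add (numeral_tm n) One"

lemma tm_val_numeral_tm [simp]: "tm_val int_struct e (numeral_tm n) = int n"
  by (induction n) simp_all

lemma fv_tm_numeral_tm [simp]: "fv_tm (numeral_tm n) = {}"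
  by (induction n) simp_all

text \<open>The language has no subtraction, so \<open>b\<close> stands on the side of the
  multiple.\<close>

definition linear_dvd_fm :: "nat \<Rightarrow> nat \<Rightarrow> fm" where
  "linear_dvd_fm a b =
    Exists 7 (Equal (Add (Mul (Var 1) (Var 7)) (numeral_tm b)) (Mul (numeral_tm a) (Var 3)))"

lemma sat_linear_dvd_fm [simp]:
  "sat int_struct e (linear_dvd_fm a b) \<longleftrightarrow> e 1 dvd int a * e 3 - int b"
proof -
  have "e 1 * z + int b = int a * e 3 \<longleftrightarrow> int a * e 3 - int b = e 1 * z" for z
    by auto
  then show ?thesis
    by (simp add: linear_dvd_fm_def dvd_def)
qed

lemma fv_linear_dvd_fm [simp]: "fv (linear_dvd_fm a b) = {1, 3}"
  by (auto simp: linear_dvd_fm_def)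

text \<open>The anchors approximate \<open>2/3\<close> at 2, \<open>1/c\<close> at 3 and \<open>1/4\<close> at all other primes.\<close>

definition num :: "nat \<Rightarrow> int" where
  "num p = (if p = 2 then 2 else 1)"

definition den :: "nat \<Rightarrow> nat \<Rightarrow> int" where
  "den c p = (if p = 2 then 3 else if p = 3 then int c else 4)"

definition dvd_fm :: "nat \<Rightarrow> fm" where
  "dvd_fm c =
    Conj (Imp (Equal (Var 0) (numeral_tm 2)) (linear_dvd_fm 3 2))
      (Conj (Imp (Equal (Var 0) (numeral_tm 3)) (linear_dvd_fm c 1))
        (Imp (Conj (Neg (Equal (Var 0) (numeral_tm 2))) (Neg (Equal (Var 0) (numeral_tm 3))))
          (linear_dvd_fm 4 1)))"

text \<open>At 2 the number 1/4 would not be a 2-adic integer, hence 2/3 there; both values of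
  \<open>c\<close> are prime to 3. None of 2/3, 1/c, 1/4 is an integer, and a prime above 3 can only
  divide the nonzero number 4k - 1.\<close>

lemma definable_anchors:
  assumes c: "c = 2 \<or> c = 4"
  shows "definable_rational_anchors num (den c) (dvd_fm c)"
proof
  fix p :: nat and k :: int and e :: "nat \<Rightarrow> int"
  assume p: "prime p"
  show "coprime (den c p) (int p)"
  proof -
    have two: "coprime 2 (int p)" if "p \<noteq> 2"
      using primes_coprime[of 2 "int p"] p that by simp
    then have "coprime (2 * 2) (int p)" if "p \<noteq> 2"
      using that by (simp only: coprime_mult_left_iff) simp
    moreover have "coprime (3 :: int) 2"
      by (rule primes_coprime) simp_all
    ultimately show ?thesis
      using c two by (auto simp: den_def)
  qed
  show "den c p * k \<noteq> num p"
    using c unfolding den_def num_def by (auto; presburger)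
  show "sat int_struct e (dvd_fm c) \<longleftrightarrow> e 1 dvd den c p * e 3 - num p" if "e 0 = int p"
    using that by (auto simp: dvd_fm_def den_def num_def)
next
  fix k :: int
  have "p \<le> max 3 (nat \<bar>4 * k - 1\<bar>)" if "int p dvd den c p * k - num p" for p
  proof (cases "p \<le> 3")
    case False
    then have "int p dvd 4 * k - 1"
      using that by (simp add: den_def num_def)
    moreover have "4 * k - 1 \<noteq> 0"
      by presburger
    ultimately have "\<bar>int p\<bar> \<le> \<bar>4 * k - 1\<bar>"
      using dvd_imp_le_int by blast
    then show ?thesis
      by simp
  qed simp
  then show "finite {p. prime p \<and> int p dvd den c p * k - num p}"
    unfolding finite_nat_set_iff_bounded_le by blast
qed (simp add: dvd_fm_def)

section \<open>The values of a_k for the two choices\<close>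

interpretation no_primes: definable_rational_anchors num "den 4" "dvd_fm 4"
  by (rule definable_anchors) simp

interpretation inf_primes: definable_rational_anchors num "den 2" "dvd_fm 2"
  by (rule definable_anchors) simp

text \<open>For nonzero k the odd number 4k - 1 is not a unit, and each of its prime factors, 3
  included, divides a_k. For k = 0 it is -1, but 3k - 2 is even: the anchor at 2 takes care of this
  case.\<close>

lemma no_primes_anchor_prod_gt_1: "anchor_prod no_primes.anchor k > 1"
proof -
  have "\<exists>p. prime p \<and> int p dvd den 4 p * k - num p"
  proof (cases "k = 0")
    case True
    then show ?thesis
      by (intro exI[of _ 2]) (simp add: den_def num_def)
  next
    case False
    then have "\<bar>4 * k - 1\<bar> \<noteq> 1"
      by presburger
    then obtain r where r: "prime r" "r dvd 4 * k - 1"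
      by (rule prime_factor_int)
    have "\<not> 2 dvd 4 * k - 1"
      by presburger
    then have "r \<noteq> 2"
      using r(2) by blast
    then have "nat r \<noteq> 2"
      by linarith
    then show ?thesis
      using r by (intro exI[of _ "nat r"]) (simp add: den_def num_def prime_ge_0_int)
  qed
  then have "anchor_prod no_primes.anchor k \<noteq> 1"
    unfolding no_primes.anchor_prod_eq_1_iff by blast
  then show ?thesis
    using no_primes.anchor_prod_pos[of k] by linarith
qed

text \<open>Let k be odd and 4k - 1 a power of 3. Then 3k - 2 is odd, no prime above 3 divides 4k -
  1, and k is 1 modulo 3, so 3 does not divide 2k - 1.\<close>

lemma inf_primes_infinite: "infinite {k. anchor_prod inf_primes.anchor k = 1}"
proof -
  have "\<exists>k. odd k \<and> 4 * k - 1 = (3 :: int) ^ (2 * j + 1)" for j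
  proof (induction j)
    case 0
    show ?case
      by (rule exI[of _ 1]) simp
  next
    case (Suc j)
    then obtain k where "odd k" "4 * k - 1 = (3 :: int) ^ (2 * j + 1)"
      by blast
    then show ?case
      \<comment> \<open>4(9k - 2) - 1 = 9(4k - 1), and 9k - 2 is odd along with k. Only odd powers
        of 3 are -1 modulo 4.\<close>
      by (intro exI[of _ "9 * k - 2"]) (auto simp: power_add)
  qed
  then obtain k :: "nat \<Rightarrow> int" where k: "\<And>j. odd (k j)" "\<And>j. 4 * k j - 1 = 3 ^ (2 * j + 1)"
    by metis
  have "inj k"
  proof (rule injI)
    fix i j assume eq: "k i = k j"
    have "(3 :: int) ^ (2 * i + 1) = 3 ^ (2 * j + 1)"
      unfolding k(2)[symmetric] eq ..
    then have "2 * i + 1 = 2 * j + 1"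
      by (rule power_inject_exp[THEN iffD1, rotated]) simp
    then show "i = j"
      by simp
  qed
  moreover have "anchor_prod inf_primes.anchor (k j) = 1" for j
    unfolding inf_primes.anchor_prod_eq_1_iff
  proof (intro allI impI notI)
    fix p assume p: "prime (p :: nat)" and dvd: "int p dvd den 2 p * k j - num p"
    have three: "(3 :: int) dvd 4 * k j - 1"
      unfolding k(2) by simp
    consider "p = 2" | "p = 3" | "p \<noteq> 2" "p \<noteq> 3"
      by blast
    then show False
    proof cases
      case 1
      then show False
        using dvd k(1)[of j] by (simp add: den_def num_def)
    next
      case 2
      then have "3 dvd 2 * k j - 1"
        using dvd by (simp add: den_def num_def)
      then show False
        using three by presburger
    next
      case 3
      then have "int p dvd 3 ^ (2 * j + 1)"
        using dvd k(2)[of j] by (simp add: den_def num_def)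
      then have "int p dvd 3"
        by (rule prime_dvd_power[rotated]) (use p in simp)
      then have "int p = 3"
        using p by (intro primes_dvd_imp_eq) simp_all
      then show False
        using 3(2) by simp
    qed
  qed
  ultimately have "infinite (range k)" "range k \<subseteq> {k. anchor_prod inf_primes.anchor k = 1}"
    using finite_imageD by auto
  then show ?thesis
    using finite_subset by blast
qed

theorem mainTheorem3:
  assumes "Dickson_Conjecture"
  shows "((\<exists>s. good_anchors TYPE(nat) galaxy_no_primes s) \<and>
          (\<forall>s. good_anchors TYPE(nat) galaxy_no_primes s \<longrightarrow>
               good_anchors TYPE('a) galaxy_no_primes s)) \<and>
         ((\<exists>s. good_anchors TYPE(nat) galaxy_inf_primes s) \<and>
          (\<forall>s. good_anchors TYPE(nat) galaxy_inf_primes s \<longrightarrow>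
               good_anchors TYPE('a) galaxy_inf_primes s))"
proof (intro conjI allI impI)
  have "good_anchors TYPE(nat) galaxy_no_primes no_primes.anchor"
    by (rule no_primes.good_anchors_anchorI[OF assms])
      (rule elementary_extension.galaxy_no_primesI[OF _ _ _ no_primes_anchor_prod_gt_1])
  then show "\<exists>s. good_anchors TYPE(nat) galaxy_no_primes s"
    by blast
  have "good_anchors TYPE(nat) galaxy_inf_primes inf_primes.anchor"
    by (rule inf_primes.good_anchors_anchorI[OF assms])
      (rule elementary_extension.galaxy_inf_primesI[OF _ _ _ inf_primes_infinite])
  then show "\<exists>s. good_anchors TYPE(nat) galaxy_inf_primes s"
    by blast
qed (fact good_anchors_no_primes_of_countable good_anchors_inf_primes_of_countable)+

end
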